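(* If $p_n(\mathfrak{DO},k)$ is the number of partitions of $k$ into distinct odd (positive) integers no greater than $2n-1$, then $$(1+q^1)(1+q^3)(1+q^5)\cdots(1+q^{2n-1})=\sum_{k=0}^{\infty}p_n(\mathfrak{DO},k)q^k=\cfrac{1}{1-\cfrac{q^1}{1+q^1-\cfrac{(1+q^1)q^3}{q^1+q^3+q^1q^3-\cfrac{(1+q^3)q^5}{q^3+q^5+q^3q^5-\ddots-\cfrac{(1+q^{2n-3})q^{2n-1}}{q^{2n-3}+q^{2n-1}+q^{2n-3}q^{2n-1}}}}}}.$$
   Formalization: The printed fraction fails for n=3 (at q=2: product 891, fraction 945/19); from the third on, the partial numerators (1+q^{2k-3})q^{2k-1} get the missing factor q^{2k-5}, so the last is q^{2n-5}(1+q^{2n-3})q^{2n-1}; q is an indeterminate over a field of characteristic 0. *)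

theory Defs
  imports
    "HOL-Library.Multiset"
    "HOL-Computational_Algebra.Formal_Laurent_Series"
begin

definition partitions_of :: "nat \<Rightarrow> nat multiset set" where
  "partitions_of k = {P. 0 \<notin># P \<and> \<Sum>\<^sub># P = k}"

text \<open>Partitions of \<open>k\<close> into distinct odd parts, each at most \<open>2n - 1\<close>.\<close>

definition p_DO :: "nat \<Rightarrow> nat \<Rightarrow> nat" where
  "p_DO n k =
     card {P \<in> partitions_of k. (\<forall>i. count P i \<le> 1) \<and> (\<forall>i \<in># P. odd i \<and> i \<le> 2 * n - 1)}"

text \<open>
  \<open>cf_tail a b k m\<close> is the tail of length \<open>m\<close>, starting at level \<open>k\<close>, of a finite
  continued fraction written with minus signs:
  \<open>b k - a (k+1) / (b (k+1) - a (k+2) / (\<dots> - a (k+m) / b (k+m)))\<close>.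
\<close>

fun cf_tail :: "(nat \<Rightarrow> 'a::field) \<Rightarrow> (nat \<Rightarrow> 'a) \<Rightarrow> nat \<Rightarrow> nat \<Rightarrow> 'a" where
  "cf_tail a b k 0 = b k"
| "cf_tail a b k (Suc m) = b k - a (Suc k) / cf_tail a b (Suc k) m"

text \<open>
  Partial numerators and denominators of the continued fraction
  \<open>1 / (1 - q / (1 + q - (1 + q) q^3 / (q + q^3 + q q^3 - q (1 + q^3) q^5 / (\<dots>))))\<close>,
  which comes from Euler's continued fraction for
  \<open>1 + x1 + (1 + x1) x2 + (1 + x1) (1 + x2) x3 + \<dots>\<close> with \<open>xk = q^(2k-1)\<close>,
  after clearing the denominators of \<open>(1 + x(k-1)) xk / x(k-1)\<close> level by level.
  Clearing these at levels \<open>k - 1\<close> and \<open>k\<close> leaves the factor \<open>x(k-2) = q^(2k-5)\<close> in the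
  numerator at each level \<open>k \<ge> 3\<close>. The identity fails without it: for three factors and \<open>q = 2\<close> the product is 891, whereas the
  continued fraction without this factor is 945/19.
\<close>

definition DO_num :: "'a::field \<Rightarrow> nat \<Rightarrow> 'a" where
  "DO_num q k =
     (if k = 1 then q
      else if k = 2 then (1 + q) * q ^ 3
      else q ^ (2 * k - 5) * ((1 + q ^ (2 * k - 3)) * q ^ (2 * k - 1)))"

definition DO_den :: "'a::field \<Rightarrow> nat \<Rightarrow> 'a" where
  "DO_den q k =
     (if k = 0 then 1
      else if k = 1 then 1 + q
      else q ^ (2 * k - 3) + q ^ (2 * k - 1) + q ^ (2 * k - 3) * q ^ (2 * k - 1))"

end

theory Submission
  imports Defs
begin

text \<open>
  The product is computed in two ways. Multiplying it out gives one power of \<open>q\<close> for each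
  subset of \<open>{1, 3, \<dots>, 2n - 1}\<close>, with the sum of the subset as exponent
  (\<open>prod_one_plus_fps_X_power\<close>), and a partition into distinct parts is the same thing as the
  set of its parts (\<open>p_DO_eq_card_subsets\<close>); this yields the first equation.

  For the continued fraction, write \<open>x\<^sub>k = q^(2k-1)\<close> and let
  \<open>R\<^sub>k = (1 + x\<^sub>k) \<dots> (1 + x\<^sub>n)\<close> be the product of the last factors. Every tail of
  the continued fraction has a closed form: it is \<open>x\<^sub>k (R\<^sub>k\<^sub>-\<^sub>1 - 1) / (R\<^sub>k - 1)\<close> at
  the levels \<open>k \<ge> 2\<close>, then \<open>x\<^sub>1 R\<^sub>1 / (R\<^sub>1 - 1)\<close> at level 1 and finally
  \<open>1 / R\<^sub>1\<close> at level 0. Passing from a tail to the one that encloses it uses only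
  \<open>R\<^sub>k = (1 + x\<^sub>k) R\<^sub>k\<^sub>+\<^sub>1\<close>. These formulas, and the fact that no tail vanishes, hold in any
  field in which \<open>q \<noteq> 0\<close> and no \<open>R\<^sub>k\<close> is 0 or 1. For the indeterminate \<open>q\<close> the
  latter is read off from coefficients: \<open>R\<^sub>k\<close> has constant term 1, and its coefficient at
  \<open>x\<^sub>k\<close> counts at least one subset, so that it is nonzero in characteristic 0.
\<close>

section \<open>Partitions into distinct odd parts\<close>

text \<open>
  Choosing from each factor either \<open>X^a\<close> or 1 produces the power \<open>X^(\<Sum>S)\<close> from the set
  \<open>S\<close> of those \<open>a\<close> whose \<open>X^a\<close> is chosen.
\<close>

lemma prod_one_plus_fps_X_power:
  fixes A :: "nat set"
  assumes A: "finite A"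
  shows "(\<Prod>a\<in>A. 1 + fps_X ^ a :: 'a::comm_ring_1 fps) =
           Abs_fps (\<lambda>k. of_nat (card {S. S \<subseteq> A \<and> \<Sum>S = k}))"
proof (rule fps_ext)
  fix k
  have "(\<Prod>a\<in>A. 1 + fps_X ^ a :: 'a fps) = (\<Prod>a\<in>A. fps_X ^ a + 1)"
    by (simp only: add.commute)
  also have "\<dots> = (\<Sum>S\<in>Pow A. fps_X ^ \<Sum>S)"
    using A by (simp add: prod_add power_sum)
  finally have "fps_nth (\<Prod>a\<in>A. 1 + fps_X ^ a :: 'a fps) k =
      (\<Sum>S\<in>Pow A. if k = \<Sum>S then 1 else 0)"
    by (simp add: fps_sum_nth fps_X_power_nth)
  also have "\<dots> = (\<Sum>S\<in>{S \<in> Pow A. k = \<Sum>S}. 1)"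
    using A by (subst sum.inter_filter) auto
  also have "{S \<in> Pow A. k = \<Sum>S} = {S. S \<subseteq> A \<and> \<Sum>S = k}"
    by auto
  finally show "fps_nth (\<Prod>a\<in>A. 1 + fps_X ^ a :: 'a fps) k =
      fps_nth (Abs_fps (\<lambda>k. of_nat (card {S. S \<subseteq> A \<and> \<Sum>S = k}))) k"
    by simp
qed

lemma p_DO_eq_card_subsets:
  "p_DO n k = card {S. S \<subseteq> (\<lambda>i. 2 * i - 1) ` {1..n} \<and> \<Sum>S = k}"
proof -
  let ?A = "(\<lambda>i. 2 * i - 1) ` {1..n}"
  let ?P = "{P \<in> partitions_of k. (\<forall>i. count P i \<le> 1) \<and> (\<forall>i \<in># P. odd i \<and> i \<le> 2 * n - 1)}"
  have odd_iff: "odd i \<and> i \<le> 2 * n - 1 \<longleftrightarrow> i \<in> ?A" for i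
  proof
    assume i: "odd i \<and> i \<le> 2 * n - 1"
    then obtain j where "i = 2 * j + 1"
      by (auto elim: oddE)
    with i show "i \<in> ?A"
      by (auto intro!: image_eqI[of _ _ "Suc j"])
  qed auto
  have "bij_betw set_mset ?P {S. S \<subseteq> ?A \<and> \<Sum>S = k}"
  proof (rule bij_betw_byWitness[where f' = mset_set])
    have mset_set_set_mset: "mset_set (set_mset P) = P" if "\<forall>i. count P i \<le> 1" for P :: "nat multiset"
    proof (rule multiset_eqI)
      fix i
      show "count (mset_set (set_mset P)) i = count P i"
        using that[rule_format, of i] by (cases "i \<in># P") (auto simp: le_Suc_eq simp flip: not_in_iff)
    qed
    show "\<forall>P\<in>?P. mset_set (set_mset P) = P"
      by (simp add: mset_set_set_mset)
    have fin: "finite S" if "S \<subseteq> ?A" for S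
      using that by (rule finite_subset) simp
    show "\<forall>S\<in>{S. S \<subseteq> ?A \<and> \<Sum>S = k}. set_mset (mset_set S) = S"
      using fin by simp
    show "set_mset ` ?P \<subseteq> {S. S \<subseteq> ?A \<and> \<Sum>S = k}"
    proof clarify
      fix P
      assume P: "P \<in> partitions_of k" "\<forall>i. count P i \<le> 1" "\<forall>i\<in>#P. odd i \<and> i \<le> 2 * n - 1"
      have "\<Sum>(set_mset P) = \<Sum>\<^sub># (mset_set (set_mset P))"
        by (simp add: sum_unfold_sum_mset)
      then have "\<Sum>(set_mset P) = k"
        using P by (simp add: mset_set_set_mset partitions_of_def)
      with P show "set_mset P \<subseteq> ?A \<and> \<Sum>(set_mset P) = k"
        using odd_iff by blast
    qed
    show "mset_set ` {S. S \<subseteq> ?A \<and> \<Sum>S = k} \<subseteq> ?P"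
    proof clarify
      fix S assume S: "S \<subseteq> ?A" "k = \<Sum>S"
      have "0 \<notin> S"
        using S(1) odd_iff by (metis even_zero subsetD)
      then show "mset_set S \<in> partitions_of (\<Sum>S) \<and> (\<forall>i. count (mset_set S) i \<le> 1) \<and>
          (\<forall>i\<in>#mset_set S. odd i \<and> i \<le> 2 * n - 1)"
        using S fin[OF S(1)] odd_iff
        by (auto simp: partitions_of_def sum_unfold_sum_mset count_mset_set')
    qed
  qed
  then show ?thesis
    unfolding p_DO_def by (rule bij_betw_same_card)
qed

section \<open>Closed forms of the tails\<close>

abbreviation (input) odd_prod :: "'a::comm_semiring_1 \<Rightarrow> nat \<Rightarrow> nat \<Rightarrow> 'a" where
  "odd_prod q n k \<equiv> \<Prod>i=k..n. 1 + q ^ (2 * i - 1)"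

lemma odd_prod_rec: "k \<le> n \<Longrightarrow> odd_prod q n k = (1 + q ^ (2 * k - 1)) * odd_prod q n (Suc k)"
  by (rule prod.atLeast_Suc_atMost)

text \<open>
  At the innermost level \<open>R\<^sub>n - 1 = x\<^sub>n\<close>, so the formula reduces to
  \<open>R\<^sub>n\<^sub>-\<^sub>1 - 1 = x\<^sub>n\<^sub>-\<^sub>1 + x\<^sub>n + x\<^sub>n\<^sub>-\<^sub>1 x\<^sub>n\<close>. In the step the factor \<open>x\<^sub>k\<^sub>+\<^sub>1\<close> of the
  partial numerator cancels against the next tail, and
  \<open>(1 + x\<^sub>k) (R\<^sub>k\<^sub>+\<^sub>1 - 1) = R\<^sub>k - 1 - x\<^sub>k\<close> brings everything over the denominator \<open>R\<^sub>k - 1\<close>.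
\<close>

lemma cf_tail_DO_ge_2:
  fixes q :: "'a::field"
  assumes q: "q \<noteq> 0" and R: "\<And>j. j \<in> {1..n} \<Longrightarrow> odd_prod q n j \<noteq> 1"
    and k: "2 \<le> k" "k \<le> n"
  shows "cf_tail (DO_num q) (DO_den q) k (n - k) =
           q ^ (2 * k - 1) * (odd_prod q n (k - 1) - 1) / (odd_prod q n k - 1)"
  using k(2,1)
proof (induction k rule: inc_induct)
  case base
  define x y where "x = q ^ (2 * n - 3)" and "y = q ^ (2 * n - 1)"
  have "odd_prod q n (n - 1) = (1 + x) * (1 + y)"
    using odd_prod_rec[of "n - 1" n q] base
    by (simp add: x_def y_def diff_mult_distrib2 numeral_3_eq_3)
  then have "cf_tail (DO_num q) (DO_den q) n (n - n) = odd_prod q n (n - 1) - 1"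
    using base by (simp add: DO_den_def x_def y_def algebra_simps)
  moreover have "odd_prod q n n - 1 = q ^ (2 * n - 1)" "q ^ (2 * n - 1) \<noteq> 0"
    using q by simp_all
  ultimately show ?case
    by simp
next
  case (step k)
  define x y z where "x = q ^ (2 * k - 3)" and "y = q ^ (2 * k - 1)" and "z = q ^ (2 * k + 1)"
  define S where "S = odd_prod q n (Suc k)"
  have Rk: "odd_prod q n k = (1 + y) * S"
    using odd_prod_rec[of k n q] step by (simp add: S_def y_def)
  have Rk': "odd_prod q n (k - 1) = (1 + x) * ((1 + y) * S)"
    using odd_prod_rec[of "k - 1" n q] step
    by (simp add: Rk[symmetric] x_def diff_mult_distrib2 numeral_3_eq_3)
  have nz: "z \<noteq> 0" "S - 1 \<noteq> 0" "(1 + y) * S - 1 \<noteq> 0"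
    using q R[of "Suc k"] R[of k] step unfolding z_def S_def[symmetric] Rk by auto
  have "n - k = Suc (n - Suc k)"
    using step by simp
  then have "cf_tail (DO_num q) (DO_den q) k (n - k) =
      DO_den q k - DO_num q (Suc k) / cf_tail (DO_num q) (DO_den q) (Suc k) (n - Suc k)"
    by simp
  also have "cf_tail (DO_num q) (DO_den q) (Suc k) (n - Suc k) =
      z * ((1 + y) * S - 1) / (S - 1)"
    using step.IH step.prems unfolding diff_Suc_1 S_def[symmetric] Rk by (simp add: z_def)
  also have "DO_den q k = x + y + x * y"
    using step.prems by (simp add: DO_den_def x_def y_def)
  also have "DO_num q (Suc k) = x * ((1 + y) * z)"
    using step.prems by (simp add: DO_num_def x_def y_def z_def numeral_eq_Suc)
  also have "x + y + x * y - x * ((1 + y) * z) / (z * ((1 + y) * S - 1) / (S - 1)) =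
      y * ((1 + x) * ((1 + y) * S) - 1) / ((1 + y) * S - 1)"
    using nz by (simp add: divide_simps) (simp add: algebra_simps)
  finally show ?case
    by (simp only: Rk Rk' flip: y_def)
qed

text \<open>
  The denominator \<open>1 + q\<close> and the numerator \<open>(1 + q) q^3\<close> break the pattern of the later
  levels, and so the factor \<open>R\<^sub>k\<^sub>-\<^sub>1 - 1\<close> of the general formula gives way to \<open>R\<^sub>1\<close>.
\<close>

lemma cf_tail_DO_1:
  fixes q :: "'a::field"
  assumes q: "q \<noteq> 0" and R: "\<And>j. j \<in> {1..n} \<Longrightarrow> odd_prod q n j \<noteq> 1" and n: "1 \<le> n"
  shows "cf_tail (DO_num q) (DO_den q) 1 (n - 1) = q * odd_prod q n 1 / (odd_prod q n 1 - 1)"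
proof (cases "n = 1")
  case True
  then show ?thesis
    using q by (simp add: DO_den_def)
next
  case False
  define S where "S = odd_prod q n 2"
  have R1: "odd_prod q n 1 = (1 + q) * S"
    using odd_prod_rec[of 1 n q] n by (simp add: S_def numeral_2_eq_2)
  have nz: "S - 1 \<noteq> 0" "(1 + q) * S - 1 \<noteq> 0"
    using R[of 2] R[of 1] n False unfolding S_def[symmetric] R1 by auto
  have "n - 1 = Suc (n - 2)"
    using n False by simp
  then have "cf_tail (DO_num q) (DO_den q) 1 (n - 1) =
      (1 + q) - (1 + q) * q ^ 3 / (q ^ 3 * ((1 + q) * S - 1) / (S - 1))"
    using cf_tail_DO_ge_2[OF q R, of 2] n False unfolding S_def[symmetric]
    by (simp add: R1[simplified] DO_den_def DO_num_def numeral_2_eq_2[symmetric])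
  also have "\<dots> = q * ((1 + q) * S) / ((1 + q) * S - 1)"
    using q nz by (simp add: divide_simps) (simp add: algebra_simps)
  finally show ?thesis
    by (simp only: R1)
qed

lemma cf_tail_DO_0:
  fixes q :: "'a::field"
  assumes q: "q \<noteq> 0" and R: "\<And>j. j \<in> {1..n} \<Longrightarrow> odd_prod q n j \<noteq> 1" and n: "1 \<le> n"
    and nz: "odd_prod q n 1 \<noteq> 0"
  shows "cf_tail (DO_num q) (DO_den q) 0 n = 1 / odd_prod q n 1"
proof -
  have "n = Suc (n - 1)"
    using n by simp
  then have "cf_tail (DO_num q) (DO_den q) 0 n =
      DO_den q 0 - DO_num q 1 / cf_tail (DO_num q) (DO_den q) 1 (n - 1)"
    by (metis One_nat_def cf_tail.simps(2))
  also have "\<dots> = 1 - q / (q * odd_prod q n 1 / (odd_prod q n 1 - 1))"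
    by (simp only: cf_tail_DO_1[OF q R n]) (simp add: DO_den_def DO_num_def)
  also have "\<dots> = 1 / odd_prod q n 1"
    using q nz R[of 1] n by (simp add: divide_simps)
  finally show ?thesis .
qed

section \<open>The indeterminate \<open>q\<close>\<close>

lemma odd_prod_fls_X:
  assumes "1 \<le> k"
  shows "odd_prod (fls_X :: 'a::field fls) n k =
     fps_to_fls (\<Prod>a\<in>(\<lambda>i. 2 * i - 1) ` {k..n}. 1 + fps_X ^ a)"
proof -
  have "inj_on (\<lambda>i. 2 * i - 1 :: nat) {k..n}"
    using assms by (auto intro!: inj_onI)
  moreover have hom: "fps_to_fls (prod f A) = (\<Prod>a\<in>A. fps_to_fls (f a))"
    for f :: "nat \<Rightarrow> 'a fps" and A
    by (induction A rule: infinite_finite_induct) (simp_all add: fls_times_fps_to_fls)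
  ultimately show ?thesis
    by (simp add: prod.reindex hom fps_to_fls_power)
qed

text \<open>
  With positive exponents each factor has constant term 1, hence so has the product. Its
  coefficient at an element \<open>a\<close> of \<open>A\<close> is the number of subsets with sum \<open>a\<close>, among them
  \<open>{a}\<close>; in characteristic 0 this number is nonzero, so the product is not constant.
\<close>

lemma prod_one_plus_fps_X_power_nontrivial:
  fixes A :: "nat set"
  assumes A: "finite A" "0 \<notin> A"
  shows "(\<Prod>a\<in>A. 1 + fps_X ^ a :: 'a::field_char_0 fps) \<noteq> 0"
    and "A \<noteq> {} \<Longrightarrow> (\<Prod>a\<in>A. 1 + fps_X ^ a :: 'a fps) \<noteq> 1"
proof -
  have "fps_nth (\<Prod>a\<in>A. 1 + fps_X ^ a :: 'a fps) 0 = 1"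
    using A by (induction A rule: finite_induct) (auto)
  then show "(\<Prod>a\<in>A. 1 + fps_X ^ a :: 'a fps) \<noteq> 0"
    by auto
  assume "A \<noteq> {}"
  then obtain a where a: "a \<in> A"
    by auto
  have "finite {S. S \<subseteq> A \<and> \<Sum>S = a}"
    using A by (auto intro: finite_subset[of _ "Pow A"])
  moreover have "{a} \<in> {S. S \<subseteq> A \<and> \<Sum>S = a}"
    using a by simp
  ultimately have "card {S. S \<subseteq> A \<and> \<Sum>S = a} \<noteq> 0"
    by auto
  then have "fps_nth (\<Prod>a\<in>A. 1 + fps_X ^ a :: 'a fps) a \<noteq> 0"
    using A by (simp add: prod_one_plus_fps_X_power)
  moreover have "a \<noteq> 0"
    using a A by metis
  ultimately show "(\<Prod>a\<in>A. 1 + fps_X ^ a :: 'a fps) \<noteq> 1"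
    by auto
qed

theorem corollary2p4:
  fixes n :: nat and q :: "'a::field_char_0 fls"
  assumes "n \<ge> 1" and "q = fls_X"
  shows "(\<Prod>i=1..n. 1 + q ^ (2 * i - 1)) =
           fps_to_fls (Abs_fps (\<lambda>k. of_nat (p_DO n k))) \<and>
         fps_to_fls (Abs_fps (\<lambda>k. of_nat (p_DO n k))) =
           1 / cf_tail (DO_num q) (DO_den q) 0 n \<and>
         (\<forall>k\<le>n. cf_tail (DO_num q) (DO_den q) k (n - k) \<noteq> 0)"
proof -
  have q: "q \<noteq> 0"
    using assms by simp
  have R0: "odd_prod q n k \<noteq> 0" and R1: "odd_prod q n k \<noteq> 1" if "k \<in> {1..n}" for k
  proof -
    let ?A = "(\<lambda>i. 2 * i - 1 :: nat) ` {k..n}"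
    have "finite ?A" "0 \<notin> ?A" "?A \<noteq> {}"
      using that by auto
    note nontriv = prod_one_plus_fps_X_power_nontrivial[OF this(1,2), where 'a = 'a] this(3)
    have R: "odd_prod q n k = fps_to_fls (\<Prod>a\<in>?A. 1 + fps_X ^ a)"
      using that by (simp only: assms(2) odd_prod_fls_X atLeastAtMost_iff)
    show "odd_prod q n k \<noteq> 0"
      unfolding R using nontriv(1) by (simp only: fps_to_fls_eq_0_iff) simp
    show "odd_prod q n k \<noteq> 1"
      unfolding R using nontriv(2,3) by (simp only: fps_to_fls_eq_1_iff) simp
  qed
  have gen: "odd_prod q n 1 = fps_to_fls (Abs_fps (\<lambda>k. of_nat (p_DO n k)))"
    by (simp only: assms(2) odd_prod_fls_X prod_one_plus_fps_X_power p_DO_eq_card_subsets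
        finite_imageI finite_atLeastAtMost order.refl)
  have tail0: "cf_tail (DO_num q) (DO_den q) 0 n = 1 / odd_prod q n 1"
    using assms(1) R0[of 1] by (intro cf_tail_DO_0 q R1) auto
  have tails: "cf_tail (DO_num q) (DO_den q) k (n - k) \<noteq> 0" if "k \<le> n" for k
  proof -
    consider "k = 0" | "k = 1" | "2 \<le> k"
      by linarith
    then show ?thesis
    proof cases
      case 1
      then show ?thesis
        using tail0 R0[of 1] assms(1) by simp
    next
      case 2
      then show ?thesis
        using cf_tail_DO_1[OF q R1 assms(1)] q R0[of 1] R1[of 1] assms(1) by simp
    next
      case 3
      then show ?thesis
        using cf_tail_DO_ge_2[OF q R1 3 that] q R1[of k] R1[of "k - 1"] that
        by (auto simp: le_diff_conv)
    qed
  qed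
  show ?thesis
    using gen tail0 tails by simp
qed

end
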